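(* Let $n\ge 1$ and let $\Theta=(\alpha,\beta,\gamma)\in\mathfrak{A}_n$. Then there exists a bijection between the set $LS(\Theta)$ of Latin squares of order $n$ having $\Theta$ as an autotopism and the set of feasible solutions of a combinatorial optimization problem (with variables $x_{ijk}$, $i,j,k\in[n]$) whose set of constraints is $$\sum_{i\in[n]}x_{ijk}=1\ \ \forall j,k\in[n];\qquad \sum_{j\in[n]}x_{ijk}=1\ \ \forall i,k\in[n];\qquad \sum_{k\in[n]}x_{ijk}=1\ \ \forall i,j\in[n];$$ $$x_{ijk}\in\{0,1\}\ \ \forall i,j,k\in[n];\qquad x_{ijk}=x_{\alpha(i)\beta(j)\gamma(k)}\ \ \forall i,j,k\in[n].$$
   Context: $[n]=\{1,2,\dots,n\}$ and $S_n$ is the group of permutations of $[n]$. A Latin square of order $n$ is an $n\times n$ array $L=(l_{i,j})$ with entries in $[n]$ such that each symbol occurs exactly once in each row and exactly once in each column; $LS(n)$ is the set of all of them. An isotopism is a triple $\Theta=(\alpha,\beta,\gamma)\in S_n\times S_n\times S_n$, where $\alpha,\beta,\gamma$ permute rows, columns and symbols respectively; it maps $L=(l_{i,j})$ to the Latin square whose entry in position $(\alpha(i),\beta(j))$ is $\gamma(l_{i,j})$. $\Theta$ is an autotopism of $L$ if it maps $L$ to itself, i.e. $l_{\alpha(i),\beta(j)}=\gamma(l_{i,j})$ for all $i,j\in[n]$. $\mathfrak{A}_n$ denotes the set of all isotopisms that are autotopisms of at least one Latin square of order $n$, and, for $\Theta\in\mathfrak{A}_n$, $LS(\Theta)$ is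 the set of all $L\in LS(n)$ for which $\Theta$ is an autotopism. A feasible solution is an assignment of values to the variables $x_{ijk}$ satisfying all the constraints (the objective function plays no role in feasibility). A Latin square $L=(l_{i,j})$ is represented by $x_{ijk}=1$ if $l_{i,j}=k$ and $x_{ijk}=0$ otherwise. *)

theory Defs
  imports Complex_Main "HOL-Library.FuncSet" "HOL-Combinatorics.Permutations"
begin

(* Arrays indexed by finite sets are extensional functions, i.e. undefined outside
   the index set, so that equality of arrays is equality of their entries. *)

definition latin_squares :: "nat \<Rightarrow> (nat \<times> nat \<Rightarrow> nat) set" where
  "latin_squares n = {L \<in> {1..n} \<times> {1..n} \<rightarrow>\<^sub>E {1..n}.
     (\<forall>i\<in>{1..n}. \<forall>k\<in>{1..n}. \<exists>!j. j \<in> {1..n} \<and> L (i, j) = k) \<and>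
     (\<forall>j\<in>{1..n}. \<forall>k\<in>{1..n}. \<exists>!i. i \<in> {1..n} \<and> L (i, j) = k)}"

type_synonym isotopism = "(nat \<Rightarrow> nat) \<times> (nat \<Rightarrow> nat) \<times> (nat \<Rightarrow> nat)"

definition isotopisms :: "nat \<Rightarrow> isotopism set" where
  "isotopisms n = {(\<alpha>, \<beta>, \<gamma>). \<alpha> permutes {1..n} \<and> \<beta> permutes {1..n} \<and> \<gamma> permutes {1..n}}"

(* The array with entry \<gamma> (L (i, j)) in position (\<alpha> i, \<beta> j); see isotopic_image_entry. *)
definition isotopic_image ::
  "nat \<Rightarrow> isotopism \<Rightarrow> (nat \<times> nat \<Rightarrow> nat) \<Rightarrow> (nat \<times> nat \<Rightarrow> nat)" where
  "isotopic_image n = (\<lambda>(\<alpha>, \<beta>, \<gamma>) L.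
     restrict (\<lambda>(i, j). \<gamma> (L (inv \<alpha> i, inv \<beta> j))) ({1..n} \<times> {1..n}))"

definition is_autotopism :: "nat \<Rightarrow> isotopism \<Rightarrow> (nat \<times> nat \<Rightarrow> nat) \<Rightarrow> bool" where
  "is_autotopism n \<Theta> L \<longleftrightarrow> \<Theta> \<in> isotopisms n \<and> isotopic_image n \<Theta> L = L"

definition autotopisms :: "nat \<Rightarrow> isotopism set" where
  "autotopisms n = {\<Theta> \<in> isotopisms n. \<exists>L \<in> latin_squares n. is_autotopism n \<Theta> L}"

definition LS :: "nat \<Rightarrow> isotopism \<Rightarrow> (nat \<times> nat \<Rightarrow> nat) set" where
  "LS n \<Theta> = {L \<in> latin_squares n. is_autotopism n \<Theta> L}"

definition feasible_solutions :: "nat \<Rightarrow> isotopism \<Rightarrow> (nat \<times> nat \<times> nat \<Rightarrow> real) set" where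
  "feasible_solutions n = (\<lambda>(\<alpha>, \<beta>, \<gamma>).
     {x \<in> {1..n} \<times> {1..n} \<times> {1..n} \<rightarrow>\<^sub>E UNIV.
       (\<forall>j\<in>{1..n}. \<forall>k\<in>{1..n}. (\<Sum>i\<in>{1..n}. x (i, j, k)) = 1) \<and>
       (\<forall>i\<in>{1..n}. \<forall>k\<in>{1..n}. (\<Sum>j\<in>{1..n}. x (i, j, k)) = 1) \<and>
       (\<forall>i\<in>{1..n}. \<forall>j\<in>{1..n}. (\<Sum>k\<in>{1..n}. x (i, j, k)) = 1) \<and>
       (\<forall>i\<in>{1..n}. \<forall>j\<in>{1..n}. \<forall>k\<in>{1..n}. x (i, j, k) \<in> {0, 1}) \<and>
       (\<forall>i\<in>{1..n}. \<forall>j\<in>{1..n}. \<forall>k\<in>{1..n}. x (i, j, k) = x (\<alpha> i, \<beta> j, \<gamma> k))})"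

lemma isotopic_image_entry:
  assumes "(\<alpha>, \<beta>, \<gamma>) \<in> isotopisms n" "i \<in> {1..n}" "j \<in> {1..n}"
  shows "isotopic_image n (\<alpha>, \<beta>, \<gamma>) L (\<alpha> i, \<beta> j) = \<gamma> (L (i, j))"
proof -
  have p: "\<alpha> permutes {1..n}" "\<beta> permutes {1..n}"
    using assms(1) by (auto simp: isotopisms_def)
  then have "\<alpha> i \<in> {1..n}" "\<beta> j \<in> {1..n}"
    using assms permutes_in_image by metis+
  then show ?thesis
    unfolding isotopic_image_def by (simp add: permutes_inverses[OF p(1)] permutes_inverses[OF p(2)])
qed

lemma is_autotopism_iff:
  assumes \<Theta>: "(\<alpha>, \<beta>, \<gamma>) \<in> isotopisms n" and L: "L \<in> latin_squares n"
  shows "is_autotopism n (\<alpha>, \<beta>, \<gamma>) L \<longleftrightarrow>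
    (\<forall>i\<in>{1..n}. \<forall>j\<in>{1..n}. L (\<alpha> i, \<beta> j) = \<gamma> (L (i, j)))"
proof
  assume "is_autotopism n (\<alpha>, \<beta>, \<gamma>) L"
  then show "\<forall>i\<in>{1..n}. \<forall>j\<in>{1..n}. L (\<alpha> i, \<beta> j) = \<gamma> (L (i, j))"
    using isotopic_image_entry[OF \<Theta>] unfolding is_autotopism_def by metis
next
  assume R: "\<forall>i\<in>{1..n}. \<forall>j\<in>{1..n}. L (\<alpha> i, \<beta> j) = \<gamma> (L (i, j))"
  have p: "\<alpha> permutes {1..n}" "\<beta> permutes {1..n}"
    using \<Theta> by (auto simp: isotopisms_def)
  have ext: "L \<in> extensional ({1..n} \<times> {1..n})"
    using L by (auto simp: latin_squares_def PiE_def)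
  have "isotopic_image n (\<alpha>, \<beta>, \<gamma>) L = L"
  proof (rule extensionalityI[OF _ ext])
    show "isotopic_image n (\<alpha>, \<beta>, \<gamma>) L \<in> extensional ({1..n} \<times> {1..n})"
      by (simp add: isotopic_image_def)
  next
    fix z assume "z \<in> {1..n} \<times> {1..n}"
    then obtain a b where z: "z = (a, b)" "a \<in> {1..n}" "b \<in> {1..n}" by blast
    have i: "inv \<alpha> a \<in> {1..n}" "inv \<beta> b \<in> {1..n}"
      using z permutes_in_image[OF permutes_inv[OF p(1)]] permutes_in_image[OF permutes_inv[OF p(2)]] by blast+
    then show "isotopic_image n (\<alpha>, \<beta>, \<gamma>) L z = L z"
      using isotopic_image_entry[OF \<Theta> i, of L] R z(1)
      by (metis permutes_inverses(1)[OF p(1)] permutes_inverses(1)[OF p(2)])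
  qed
  then show "is_autotopism n (\<alpha>, \<beta>, \<gamma>) L" using \<Theta> by (simp add: is_autotopism_def)
qed

end

theory Submission
  imports Defs
begin

text \<open>The bijection sends an array \<open>L\<close> to its incidence tensor, which is 1 at \<open>(i, j, k)\<close> if
  \<open>L (i, j) = k\<close> and 0 otherwise. A sum of zeros and ones equals 1 exactly when a single summand is 1
  (\<open>sum_zero_one_eq_1_iff\<close>). Hence, for such a tensor, the row and column constraints express that
  each symbol occurs once in each row and column, and the symmetry constraint expresses that
  \<open>(\<alpha>, \<beta>, \<gamma>)\<close> maps \<open>L\<close> to itself: among arrays, exactly the elements of \<open>LS n (\<alpha>, \<beta>, \<gamma>)\<close> have
  feasible incidence tensors (\<open>incidence_feasible_iff\<close>). The constraints on the sums over \<open>k\<close>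
  say that each cell of a feasible solution carries a single symbol, so every feasible solution is
  an incidence tensor (\<open>feasible_is_incidence\<close>). The array can be read off its tensor, which
  gives injectivity (\<open>incidence_inj_on\<close>).\<close>

definition incidence :: "nat \<Rightarrow> (nat \<times> nat \<Rightarrow> nat) \<Rightarrow> (nat \<times> nat \<times> nat \<Rightarrow> real)" where
  "incidence n L =
     restrict (\<lambda>(i, j, k). if L (i, j) = k then 1 else 0) ({1..n} \<times> {1..n} \<times> {1..n})"

lemma incidence_apply [simp]:
  assumes "i \<in> {1..n}" "j \<in> {1..n}" "k \<in> {1..n}"
  shows "incidence n L (i, j, k) = (if L (i, j) = k then 1 else 0)"
  using assms by (simp add: incidence_def)

text \<open>Such a sum counts the ones among its terms.\<close>

lemma sum_zero_one_eq_1_iff: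
  fixes f :: "'a \<Rightarrow> 'b::{semiring_1, semiring_char_0}"
  assumes "finite A" "\<And>a. a \<in> A \<Longrightarrow> f a \<in> {0, 1}"
  shows "sum f A = 1 \<longleftrightarrow> (\<exists>!a. a \<in> A \<and> f a = 1)"
proof -
  have "sum f A = (\<Sum>a\<in>A. if f a = 1 then 1 else 0)"
    using assms(2) by (intro sum.cong) auto
  also have "\<dots> = of_nat (card {a \<in> A. f a = 1})"
    using assms(1) by (simp add: sum.If_cases Int_def conj_commute)
  finally have "sum f A = 1 \<longleftrightarrow> card {a \<in> A. f a = 1} = 1"
    by simp
  also have "\<dots> \<longleftrightarrow> (\<exists>!a. a \<in> A \<and> f a = 1)"
    by (simp add: card_1_singleton_iff set_eq_iff) metis
  finally show ?thesis .
qed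

lemma incidence_inj_on: "inj_on (incidence n) ({1..n} \<times> {1..n} \<rightarrow>\<^sub>E {1..n})"
proof (rule inj_onI)
  fix L M
  assume L: "L \<in> {1..n} \<times> {1..n} \<rightarrow>\<^sub>E {1..n}" and M: "M \<in> {1..n} \<times> {1..n} \<rightarrow>\<^sub>E {1..n}"
    and eq: "incidence n L = incidence n M"
  show "L = M"
  proof (rule PiE_ext[OF L M])
    fix z assume z: "z \<in> {1..n} \<times> {1..n}"
    then obtain i j where ij: "z = (i, j)" "i \<in> {1..n}" "j \<in> {1..n}" by blast
    have k: "L (i, j) \<in> {1..n}" using L z ij(1) by blast
    have "incidence n M (i, j, L (i, j)) = 1"
      using incidence_apply[OF ij(2,3) k, of L] eq by simp
    then show "L z = M z"
      using incidence_apply[OF ij(2,3) k, of M] ij(1) by (simp split: if_splits)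
  qed
qed

text \<open>Constraint by constraint, feasibility of the tensor is a property of the array. The sums over
  symbols are automatic, because an array has one entry in each cell.\<close>

lemma incidence_feasible_iff:
  assumes L: "L \<in> {1..n} \<times> {1..n} \<rightarrow>\<^sub>E {1..n}"
    and \<Theta>: "(\<alpha>, \<beta>, \<gamma>) \<in> isotopisms n"
  shows "incidence n L \<in> feasible_solutions n (\<alpha>, \<beta>, \<gamma>) \<longleftrightarrow> L \<in> LS n (\<alpha>, \<beta>, \<gamma>)"
proof -
  let ?x = "incidence n L" and ?N = "{1..n}"
  have p: "\<alpha> permutes ?N" "\<beta> permutes ?N" "\<gamma> permutes ?N"
    using \<Theta> by (auto simp: isotopisms_def)
  have Lmem: "L (i, j) \<in> ?N" if "i \<in> ?N" "j \<in> ?N" for i j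
    using L that by blast
  have column: "(\<Sum>i\<in>?N. ?x (i, j, k)) = 1 \<longleftrightarrow> (\<exists>!i. i \<in> ?N \<and> L (i, j) = k)"
    if "j \<in> ?N" "k \<in> ?N" for j k
    using that by (subst sum_zero_one_eq_1_iff) (auto cong: conj_cong)
  have row: "(\<Sum>j\<in>?N. ?x (i, j, k)) = 1 \<longleftrightarrow> (\<exists>!j. j \<in> ?N \<and> L (i, j) = k)"
    if "i \<in> ?N" "k \<in> ?N" for i k
    using that by (subst sum_zero_one_eq_1_iff) (auto cong: conj_cong)
  have cell: "(\<Sum>k\<in>?N. ?x (i, j, k)) = 1" if "i \<in> ?N" "j \<in> ?N" for i j
  proof -
    have "(\<Sum>k\<in>?N. ?x (i, j, k)) = (\<Sum>k\<in>?N. if L (i, j) = k then 1 else 0)"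
      using that by (intro sum.cong) auto
    also have "\<dots> = 1" using Lmem[OF that] by simp
    finally show ?thesis .
  qed
  have symmetry: "(\<forall>k\<in>?N. ?x (i, j, k) = ?x (\<alpha> i, \<beta> j, \<gamma> k)) \<longleftrightarrow> L (\<alpha> i, \<beta> j) = \<gamma> (L (i, j))"
    if ij: "i \<in> ?N" "j \<in> ?N" for i j
  proof -
    have img: "\<alpha> i \<in> ?N" "\<beta> j \<in> ?N" "\<And>k. \<gamma> k \<in> ?N \<longleftrightarrow> k \<in> ?N"
      using ij permutes_in_image[OF p(1)] permutes_in_image[OF p(2)] permutes_in_image[OF p(3)]
      by blast+
    have "(\<forall>k\<in>?N. ?x (i, j, k) = ?x (\<alpha> i, \<beta> j, \<gamma> k)) \<longleftrightarrow>
        (\<forall>k\<in>?N. L (i, j) = k \<longleftrightarrow> L (\<alpha> i, \<beta> j) = \<gamma> k)"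
      using ij img by (intro ball_cong refl) simp
    (* Left to right, take k = L (i, j); right to left, use the injectivity of \<gamma>. *)
    also have "\<dots> \<longleftrightarrow> L (\<alpha> i, \<beta> j) = \<gamma> (L (i, j))"
      using Lmem[OF ij] inj_eq[OF permutes_inj[OF p(3)]] by metis
    finally show ?thesis .
  qed
  have columns: "(\<forall>j\<in>?N. \<forall>k\<in>?N. (\<Sum>i\<in>?N. ?x (i, j, k)) = 1) \<longleftrightarrow>
      (\<forall>j\<in>?N. \<forall>k\<in>?N. \<exists>!i. i \<in> ?N \<and> L (i, j) = k)"
    by (intro ball_cong refl column)
  have rows: "(\<forall>i\<in>?N. \<forall>k\<in>?N. (\<Sum>j\<in>?N. ?x (i, j, k)) = 1) \<longleftrightarrow>
      (\<forall>i\<in>?N. \<forall>k\<in>?N. \<exists>!j. j \<in> ?N \<and> L (i, j) = k)"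
    by (intro ball_cong refl row)
  have cells: "(\<forall>i\<in>?N. \<forall>j\<in>?N. (\<Sum>k\<in>?N. ?x (i, j, k)) = 1) \<longleftrightarrow> True"
    using cell by simp
  have zero_one: "(\<forall>i\<in>?N. \<forall>j\<in>?N. \<forall>k\<in>?N. ?x (i, j, k) \<in> {0, 1}) \<longleftrightarrow> True"
    by simp
  have symmetric: "(\<forall>i\<in>?N. \<forall>j\<in>?N. \<forall>k\<in>?N. ?x (i, j, k) = ?x (\<alpha> i, \<beta> j, \<gamma> k)) \<longleftrightarrow>
      (\<forall>i\<in>?N. \<forall>j\<in>?N. L (\<alpha> i, \<beta> j) = \<gamma> (L (i, j)))"
    by (intro ball_cong refl symmetry)
  have array: "?x \<in> ?N \<times> ?N \<times> ?N \<rightarrow>\<^sub>E UNIV" by (simp add: incidence_def)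
  have "?x \<in> feasible_solutions n (\<alpha>, \<beta>, \<gamma>) \<longleftrightarrow>
      L \<in> latin_squares n \<and> (\<forall>i\<in>?N. \<forall>j\<in>?N. L (\<alpha> i, \<beta> j) = \<gamma> (L (i, j)))"
    unfolding feasible_solutions_def latin_squares_def mem_Collect_eq prod.case
      columns rows cells zero_one symmetric
    by (simp only: array L simp_thms conj_ac)
  also have "\<dots> \<longleftrightarrow> L \<in> LS n (\<alpha>, \<beta>, \<gamma>)"
    using is_autotopism_iff[OF \<Theta>] by (auto simp: LS_def)
  finally show ?thesis .
qed

text \<open>The array places in cell \<open>(i, j)\<close> the unique symbol \<open>k\<close> with \<open>x (i, j, k) = 1\<close>.\<close>

lemma feasible_is_incidence:
  assumes "x \<in> feasible_solutions n (\<alpha>, \<beta>, \<gamma>)"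
  obtains L where "L \<in> {1..n} \<times> {1..n} \<rightarrow>\<^sub>E {1..n}" "x = incidence n L"
proof -
  let ?N = "{1..n}"
  have ext: "x \<in> extensional (?N \<times> ?N \<times> ?N)"
    and cell: "\<And>i j. i \<in> ?N \<Longrightarrow> j \<in> ?N \<Longrightarrow> (\<Sum>k\<in>?N. x (i, j, k)) = 1"
    and zero_one: "\<And>i j k. i \<in> ?N \<Longrightarrow> j \<in> ?N \<Longrightarrow> k \<in> ?N \<Longrightarrow> x (i, j, k) \<in> {0, 1}"
    using assms unfolding feasible_solutions_def PiE_def by blast+
  have ex1: "\<exists>!k. k \<in> ?N \<and> x (i, j, k) = 1" if "i \<in> ?N" "j \<in> ?N" for i j
    using cell[OF that] sum_zero_one_eq_1_iff[of ?N "\<lambda>k. x (i, j, k)"] zero_one[OF that] by blast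
  define L where "L = restrict (\<lambda>(i, j). THE k. k \<in> ?N \<and> x (i, j, k) = 1) (?N \<times> ?N)"
  have L: "L (i, j) \<in> ?N" "x (i, j, L (i, j)) = 1" if "i \<in> ?N" "j \<in> ?N" for i j
    using theI'[OF ex1[OF that]] that by (simp_all add: L_def)
  have mem: "L \<in> ?N \<times> ?N \<rightarrow>\<^sub>E ?N"
    using L(1) by (intro PiE_I) (auto simp: L_def)
  moreover have "x = incidence n L"
  proof (rule extensionalityI[OF ext])
    show "incidence n L \<in> extensional (?N \<times> ?N \<times> ?N)" by (simp add: incidence_def)
  next
    fix z assume "z \<in> ?N \<times> ?N \<times> ?N"
    then obtain i j k where z: "z = (i, j, k)" and ijk: "i \<in> ?N" "j \<in> ?N" "k \<in> ?N" by blast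
    have "x (i, j, k) = 1 \<longleftrightarrow> L (i, j) = k"
      using ex1[OF ijk(1,2)] L[OF ijk(1,2)] ijk(3) by blast
    then show "x z = incidence n L z"
      using zero_one[OF ijk] incidence_apply[OF ijk, of L] z by auto
  qed
  ultimately show ?thesis by (rule that)
qed

theorem theorem1p1:
  fixes n :: nat and \<alpha> \<beta> \<gamma> :: "nat \<Rightarrow> nat"
  assumes "n \<ge> 1"
    and "(\<alpha>, \<beta>, \<gamma>) \<in> autotopisms n"
  shows "\<exists>f. bij_betw f (LS n (\<alpha>, \<beta>, \<gamma>)) (feasible_solutions n (\<alpha>, \<beta>, \<gamma>))"
proof -
  have \<Theta>: "(\<alpha>, \<beta>, \<gamma>) \<in> isotopisms n"
    using assms(2) by (simp add: autotopisms_def)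
  have sub: "LS n (\<alpha>, \<beta>, \<gamma>) \<subseteq> {1..n} \<times> {1..n} \<rightarrow>\<^sub>E {1..n}"
    by (auto simp only: LS_def latin_squares_def)
  have "incidence n ` LS n (\<alpha>, \<beta>, \<gamma>) = feasible_solutions n (\<alpha>, \<beta>, \<gamma>)"
  proof (intro subset_antisym subsetI)
    fix x assume "x \<in> incidence n ` LS n (\<alpha>, \<beta>, \<gamma>)"
    then show "x \<in> feasible_solutions n (\<alpha>, \<beta>, \<gamma>)"
      using sub incidence_feasible_iff[OF _ \<Theta>] by blast
  next
    fix x assume "x \<in> feasible_solutions n (\<alpha>, \<beta>, \<gamma>)"
    then show "x \<in> incidence n ` LS n (\<alpha>, \<beta>, \<gamma>)"
      using feasible_is_incidence incidence_feasible_iff[OF _ \<Theta>] by (metis imageI)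
  qed
  then have "bij_betw (incidence n) (LS n (\<alpha>, \<beta>, \<gamma>)) (feasible_solutions n (\<alpha>, \<beta>, \<gamma>))"
    using inj_on_subset[OF incidence_inj_on sub] by (simp add: bij_betw_def)
  then show ?thesis by blast
qed

end
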